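(* Let $T(n)$ denote the number of array updates performed by the improved algorithm when filling in its four dimensional array for input $n$, that is, the number of quadruples of integers $(l,k,N,s)$ with $$1\le l\le n-1,\quad 1\le k\le n-3,\quad 1\le N\le \min\left\{lk,\left\lfloor \frac{n^2+3}{2}-2n\right\rfloor\right\},\quad m'(N,l)\le s\le M'(N,k).$$ Then $T(n)=\Theta(n^6)$, i.e. there exist real constants $0<a\le b$ such that $a\,n^6\le T(n)\le b\,n^6$ for all sufficiently large positive integers $n$.
   Context: For positive integers $N,k$, let $q=\lfloor N/k\rfloor$ and $r=N\bmod k$. The nonnegative integer $M'(N,k)$ is given by: - if $k<q$, $M'(N,k)=0$; - if $k\ge q$ and $r\le q$ (including $r=0$), $M'(N,k)=q(k-q+1)-r$; - if $k\ge q$ and $r>q$, $M'(N,k)=q(k-q-1)+r$. For positive integers $N,l$, let $q=\lfloor N/l\rfloor$ and $r=N\bmod l$. The nonnegative integer $m'(N,l)$ is given by: - if $l>q$, $m'(N,l)=0$; - if $l\le q$ and $r=0$, $m'(N,l)=l(q-l+1)$; - if $l\le q$ and $r>0$, $m'(N,l)=l(q-l)+r$. Background (not needed to read the claim): the improved algorithm computes the number $L(n)$ of zero-free graphical degree sequences of length $n$ with largest part less than $n-1$. It fills in a four dimensional array by four nested loops over $l,k,N,s$ with exactly the ranges in the claim, performing one update of an array element (using four previously stored values) for each quadruple. The range for $s$ is empty if $m'(N,l)>M'(N,k)$. *)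

theory Defs
  imports Complex_Main "HOL-Library.Landau_Symbols"
begin

text \<open>
  All quantities are integers, so that the subtractions below do not truncate.
  The definitions are meant for positive arguments.
\<close>

definition M' :: "int \<Rightarrow> int \<Rightarrow> int" where
  "M' N k =
     (let q = N div k; r = N mod k in
        if k < q then 0
        else if r \<le> q then q * (k - q + 1) - r
        else q * (k - q - 1) + r)"

definition m' :: "int \<Rightarrow> int \<Rightarrow> int" where
  "m' N l =
     (let q = N div l; r = N mod l in
        if l > q then 0
        else if r = 0 then l * (q - l + 1)
        else l * (q - l) + r)"

definition update_quadruples :: "nat \<Rightarrow> (int \<times> int \<times> int \<times> int) set" where
  "update_quadruples n =
     {(l, k, N, s).
        1 \<le> l \<and> l \<le> int n - 1 \<and>
        1 \<le> k \<and> k \<le> int n - 3 \<and>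
        1 \<le> N \<and> N \<le> min (l * k) \<lfloor>((real n)\<^sup>2 + 3) / 2 - 2 * real n\<rfloor> \<and>
        m' N l \<le> s \<and> s \<le> M' N k}"

text \<open>
  The cardinality below is that of a genuinely finite set, so the convention that infinite
  sets have cardinality 0 plays no role.
\<close>

lemma finite_update_quadruples: "finite (update_quadruples n)"
proof -
  let ?F = "\<lfloor>((real n)\<^sup>2 + 3) / 2 - 2 * real n\<rfloor>"
  have "update_quadruples n \<subseteq>
      (SIGMA l : {1..int n - 1}. SIGMA k : {1..int n - 3}. SIGMA N : {1..?F}. {m' N l..M' N k})"
    by (auto simp: update_quadruples_def)
  then show ?thesis
    by (rule finite_subset) (intro finite_SigmaI finite_atLeastAtMost_int)
qed

definition T :: "nat \<Rightarrow> nat" where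
  "T n = card (update_quadruples n)"

end

theory Submission
  imports Defs
begin

text \<open>
  Upper bound: \<open>0 \<le> m' N l\<close> and \<open>M' N k \<le> N\<close>, so all quadruples lie in a box with
  sides of order \<open>n, n, n\<^sup>2, n\<^sup>2\<close>. Lower bound: put \<open>m = n div 8\<close>. If \<open>l\<close> and \<open>k\<close> are in \<open>[6m, 7m)\<close> and
  \<open>N\<close> is in \<open>[7m\<^sup>2, 14m\<^sup>2)\<close>, then \<open>N div l < l\<close> gives \<open>m' N l = 0\<close>, whereas \<open>m \<le> N div k < 3m\<close> makes
  \<open>M' N k\<close> at least \<open>2m\<^sup>2\<close>. Thus the quadruples contain a box with sides \<open>m, m, 7m\<^sup>2, 2m\<^sup>2\<close>.
\<close>

text \<open>Each branch is compared with \<open>N = q * k + r\<close>, where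
  \<open>r \<ge> 0\<close>.\<close>

lemma M'_le:
  assumes "N \<ge> 1" "k \<ge> 1"
  shows "M' N k \<le> N"
proof -
  define q r where "q = N div k" and "r = N mod k"
  have N: "N = q * k + r" by (simp add: q_def r_def)
  have q: "0 \<le> q" and r: "0 \<le> r" using assms by (auto simp: q_def r_def pos_imp_zdiv_nonneg_iff)
  \<comment> \<open>The \<open>+ 1\<close> is harmless: the product vanishes for
    \<open>q = 0\<close>, and \<open>q \<ge> 1\<close> gives
    \<open>k - q + 1 \<le> k\<close>.\<close>
  have "q * (k - q + 1) \<le> N" if "r \<le> q"
  proof (cases "q = 0")
    case True
    then show ?thesis using assms by simp
  next
    case False
    then have "q * (k - q + 1) \<le> q * k" using q by (intro mult_left_mono) auto
    then show ?thesis using N r by linarith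
  qed
  moreover have "q * (k - q - 1) \<le> q * k" using q by (intro mult_left_mono) auto
  moreover have "M' N k = (if k < q then 0 else if r \<le> q then q * (k - q + 1) - r else q * (k - q - 1) + r)"
    by (simp add: M'_def Let_def q_def r_def)
  ultimately show ?thesis
    using N r assms(1) by (smt (verit))
qed

lemma m'_nonneg:
  assumes "l \<ge> 1"
  shows "0 \<le> m' N l"
  using assms by (auto simp: m'_def Let_def)

text \<open>One bound serves both branches: the excess over it is \<open>2 * q - r\<close> if
  \<open>r \<le> q\<close> and \<open>r\<close> otherwise, both nonnegative.\<close>

lemma M'_ge:
  assumes "k \<ge> 1" "N div k \<le> k"
  shows "N div k * (k - N div k - 1) \<le> M' N k"
proof -
  define q r where "q = N div k" and "r = N mod k"
  have "0 \<le> r" using assms by (simp add: r_def)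
  moreover have "q * (k - q + 1) = q * (k - q - 1) + 2 * q" by (simp add: algebra_simps)
  moreover have "M' N k = (if r \<le> q then q * (k - q + 1) - r else q * (k - q - 1) + r)"
    using assms by (simp add: M'_def Let_def q_def r_def)
  ultimately have "q * (k - q - 1) \<le> M' N k" by (smt (verit))
  then show ?thesis by (simp add: q_def)
qed

lemma T_le: "T n \<le> 2 * n ^ 6"
proof -
  let ?n = "int n"
  \<comment> \<open>This amounts to \<open>3 \<le> n ^ 2 + 4 * n\<close> over the reals. At
    \<open>n = 0\<close> the floor is 1 and the bound fails, but there the range of \<open>k\<close>
    is empty.\<close>
  have F: "\<lfloor>((real n)\<^sup>2 + 3) / 2 - 2 * real n\<rfloor> \<le> ?n ^ 2" if "n \<ge> 1"
  proof -
    have "((real n)\<^sup>2 + 3) / 2 - 2 * real n \<le> (real n)\<^sup>2"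
      using that by (simp add: field_simps add_increasing)
    then have "\<lfloor>((real n)\<^sup>2 + 3) / 2 - 2 * real n\<rfloor> \<le> \<lfloor>(real n)\<^sup>2\<rfloor>"
      by (rule floor_mono)
    also have "\<lfloor>(real n)\<^sup>2\<rfloor> = ?n ^ 2"
      by (metis floor_of_nat of_nat_power)
    finally show ?thesis .
  qed
  let ?B = "{1..?n} \<times> {1..?n} \<times> {1..?n ^ 2} \<times> {0..?n ^ 2}"
  have "update_quadruples n \<subseteq> ?B"
  proof
    fix x assume "x \<in> update_quadruples n"
    then obtain l k N s where x: "x = (l, k, N, s)" and
      h: "1 \<le> l" "l \<le> ?n - 1" "1 \<le> k" "k \<le> ?n - 3" "1 \<le> N"
         "N \<le> \<lfloor>((real n)\<^sup>2 + 3) / 2 - 2 * real n\<rfloor>" "m' N l \<le> s" "s \<le> M' N k"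
      by (auto simp: update_quadruples_def)
    have "N \<le> ?n ^ 2" using F h by linarith
    moreover have "0 \<le> s" "s \<le> N"
      using m'_nonneg[of l N] M'_le[of N k] h by linarith+
    ultimately show "x \<in> ?B" using h by (auto simp: x)
  qed
  then have "T n \<le> card ?B"
    unfolding T_def by (intro card_mono) auto
  also have "card ?B = n * (n * (n ^ 2 * (n ^ 2 + 1)))"
    by (simp add: card_cartesian_product nat_power_eq nat_add_distrib)
  \<comment> \<open>The value \<open>s = 0\<close> contributes the \<open>+ 1\<close>; absorbing it
    costs the factor 2.\<close>
  also have "\<dots> \<le> n * (n * (n ^ 2 * (2 * n ^ 2)))"
  proof (cases "n = 0")
    case False
    then have "n ^ 2 + 1 \<le> 2 * n ^ 2" using one_le_power[of n 2] by linarith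
    then show ?thesis by (intro mult_le_mono2)
  qed simp
  also have "\<dots> = 2 * n ^ 6" by (simp add: eval_nat_numeral algebra_simps)
  finally show ?thesis .
qed

text \<open>The gap between \<open>7 * m\<close> and \<open>8 * m\<close> keeps \<open>l\<close> and
  \<open>k\<close> in range: \<open>k < 7 * m \<le> n - m \<le> n - 3\<close>, as
  \<open>m \<ge> 3\<close>.\<close>

lemma box_subset_update_quadruples:
  fixes m :: int and n :: nat
  assumes m: "m \<ge> 3" and mn: "8 * m \<le> int n"
  shows "{6 * m..<7 * m} \<times> {6 * m..<7 * m} \<times> {7 * m\<^sup>2..<14 * m\<^sup>2} \<times> {0..<2 * m\<^sup>2}
           \<subseteq> update_quadruples n"
proof -
  \<comment> \<open>Up to the constant 3/2 the bound is \<open>n * (n - 4) / 2\<close>, which is at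
    least \<open>32 * m ^ 2 - 16 * m\<close>; \<open>3 * m \<le> m ^ 2\<close> absorbs the linear
    term.\<close>
  have F: "14 * m\<^sup>2 \<le> \<lfloor>((real n)\<^sup>2 + 3) / 2 - 2 * real n\<rfloor>"
  proof -
    let ?x = "real_of_int m"
    have x: "?x \<ge> 3" and xn: "8 * ?x \<le> real n" using m mn by linarith+
    have "(8 * ?x) * (8 * ?x - 4) \<le> real n * (real n - 4)"
      using x xn by (intro mult_mono) auto
    then have "64 * ?x\<^sup>2 - 32 * ?x \<le> (real n)\<^sup>2 - 4 * real n"
      by (simp add: power2_eq_square algebra_simps)
    moreover have "3 * ?x \<le> ?x\<^sup>2" using x by (simp add: power2_eq_square)
    ultimately have "14 * ?x\<^sup>2 \<le> ((real n)\<^sup>2 + 3) / 2 - 2 * real n"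
      using x by (simp add: field_simps)
    then show ?thesis by (simp add: le_floor_iff)
  qed
  have m2: "m\<^sup>2 > 0" using m by simp
  have "(l, k, N, s) \<in> update_quadruples n"
    if l: "6 * m \<le> l" "l < 7 * m" and k: "6 * m \<le> k" "k < 7 * m"
      and N: "7 * m\<^sup>2 \<le> N" "N < 14 * m\<^sup>2" and s: "0 \<le> s" "s < 2 * m\<^sup>2" for l k N s
  proof -
    \<comment> \<open>Used for both \<open>l\<close> and \<open>k\<close>; it rests on
      \<open>14 < 3 * 6\<close>.\<close>
    have q_less: "N div j < 3 * m" if "6 * m \<le> j" for j
    proof -
      have "3 * m * (6 * m) \<le> 3 * m * j" using that m by (intro mult_left_mono) auto
      then have "N < 3 * m * j" using N m2 unfolding power2_eq_square by linarith
      then show ?thesis using that m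
        by (smt (verit) div_mult_mod_eq mult_right_mono pos_mod_sign)
    qed
    have "m * k \<le> m * (7 * m)" using k m by (intro mult_left_mono) auto
    then have "m * k \<le> N" using N by (simp add: power2_eq_square)
    then have q_ge: "m \<le> N div k" using zdiv_mono1[of "m * k" N k] k m by simp
    have "m' N l = 0" using q_less[OF l(1)] l m by (simp add: m'_def Let_def)
    moreover have "2 * m\<^sup>2 \<le> M' N k"
    proof -
      \<comment> \<open>The second factor is in fact at least \<open>6 * m - 3 * m\<close>, since
        \<open>N div k + 1 \<le> 3 * m\<close>.\<close>
      have "m * (2 * m) \<le> N div k * (k - N div k - 1)"
        using q_ge q_less[OF k(1)] k m by (intro mult_mono) auto
      also have "\<dots> \<le> M' N k" using q_less[OF k(1)] k m by (intro M'_ge) auto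
      finally show ?thesis by (simp add: power2_eq_square)
    qed
    moreover have "(6 * m) * (6 * m) \<le> l * k" using l k m by (intro mult_mono) auto
    then have "N \<le> l * k" using N m2 unfolding power2_eq_square by linarith
    moreover have "N \<ge> 1" using N m2 by linarith
    ultimately show ?thesis
      using l k N s F m mn by (simp add: update_quadruples_def)
  qed
  then show ?thesis by auto
qed

lemma T_ge:
  assumes "m \<ge> 3" "8 * m \<le> n"
  shows "14 * m ^ 6 \<le> T n"
proof -
  let ?m = "int m"
  let ?B = "{6 * ?m..<7 * ?m} \<times> {6 * ?m..<7 * ?m} \<times> {7 * ?m\<^sup>2..<14 * ?m\<^sup>2} \<times> {0..<2 * ?m\<^sup>2}"
  have "14 * m ^ 6 = card ?B"
    by (simp add: card_cartesian_product nat_mult_distrib nat_power_eq power_numeral_reduce)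
  also have "\<dots> \<le> T n"
    unfolding T_def using assms
    by (intro card_mono finite_update_quadruples box_subset_update_quadruples) auto
  finally show ?thesis .
qed

theorem mainTheorem2:
  shows "(\<lambda>n. real (T n)) \<in> \<Theta>(\<lambda>n. real n ^ 6) \<and>
         (\<exists>a b :: real. 0 < a \<and> a \<le> b \<and>
            (\<forall>\<^sub>F n in sequentially. a * real n ^ 6 \<le> real (T n) \<and> real (T n) \<le> b * real n ^ 6))"
proof -
  \<comment> \<open>This comes from \<open>14 * m ^ 6\<close> with
    \<open>m = n div 8 \<ge> n / 16\<close>; \<open>n \<ge> 24\<close> ensures both this and
    \<open>m \<ge> 3\<close>.\<close>
  define a :: real where "a = 14 / 16 ^ 6"
  have bounds: "a * real n ^ 6 \<le> real (T n) \<and> real (T n) \<le> 2 * real n ^ 6" if "n \<ge> 24" for n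
  proof
    let ?m = "n div 8"
    have "real n / 16 \<le> real ?m" using that by linarith
    then have "14 * (real n / 16) ^ 6 \<le> 14 * real ?m ^ 6"
      by (intro mult_left_mono power_mono) auto
    also have "\<dots> = real (14 * ?m ^ 6)" by simp
    also have "\<dots> \<le> real (T n)" using that by (intro of_nat_mono T_ge) auto
    finally show "a * real n ^ 6 \<le> real (T n)" by (simp add: a_def power_divide)
    have "real (T n) \<le> real (2 * n ^ 6)" by (intro of_nat_mono T_le)
    then show "real (T n) \<le> 2 * real n ^ 6" by simp
  qed
  then have ev: "\<forall>\<^sub>F n in sequentially. a * real n ^ 6 \<le> real (T n) \<and> real (T n) \<le> 2 * real n ^ 6"
    by (rule eventually_sequentiallyI)
  have a: "0 < a" "a \<le> 2" by (simp_all add: a_def)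
  have "(\<lambda>n. real (T n)) \<in> \<Theta>(\<lambda>n. real n ^ 6)"
  proof (rule bigthetaI)
    show "(\<lambda>n. real (T n)) \<in> O(\<lambda>n. real n ^ 6)"
      by (rule bigoI[of _ 2]) (use ev in \<open>auto elim: eventually_mono\<close>)
    show "(\<lambda>n. real (T n)) \<in> \<Omega>(\<lambda>n. real n ^ 6)"
      by (rule landau_omega.bigI[OF a(1)]) (use ev in \<open>auto elim: eventually_mono\<close>)
  qed
  with ev a show ?thesis by blast
qed

end
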